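(* Let $A$ be an evolution algebra over a field $K$ and let $E$ be a graph associated to $A$ (relative to some natural basis). If $A$ is prime, then $E$ is downward directed.
   Context: Algebras are not assumed associative. An evolution algebra over $K$ is a $K$-algebra $A$ having a basis $B=\{e_i\}_{i\in\Lambda}$ (a natural basis) with $e_ie_j=0$ for all $i\ne j$. Write $e_i^2=\sum_{j\in\Lambda}\omega_{ji}e_j$. The directed graph $E$ associated to $A$ relative to $B$ has vertex set $E^0=\{e_i\}_{i\in\Lambda}$ and exactly one edge from $e_i$ to $e_j$ if $\omega_{ji}\neq 0$, and none otherwise. $A$ is prime if for any ideals $I,J$ of $A$ with $IJ=0$ one has $I=0$ or $J=0$. For vertices $u,v$ write $u\ge v$ if there is a directed path from $u$ to $v$ (paths of length $0$ allowed). $E$ is downward directed if for every $u,v\in E^0$ there exists $z\in E^0$ with $u\ge z$ and $v\ge z$. *)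

theory Defs
  imports Complex_Main "Graph_Theory.Arc_Walk"
begin

text \<open>
  Algebras over a field: neither associative, commutative nor unital, and of arbitrary dimension.
  The underlying space is the whole type \<open>'a\<close>, which may be a one-element type.
\<close>

locale nonassoc_algebra = vector_space scale
  for scale :: "'k::field \<Rightarrow> 'a::ab_group_add \<Rightarrow> 'a" (infixr "*s" 75) +
  fixes mult :: "'a \<Rightarrow> 'a \<Rightarrow> 'a" (infixl "\<cdot>" 70)
  assumes add_mult: "(x + y) \<cdot> z = x \<cdot> z + y \<cdot> z"
    and mult_add: "x \<cdot> (y + z) = x \<cdot> y + x \<cdot> z"
    and scale_mult: "(c *s x) \<cdot> y = c *s (x \<cdot> y)"
    and mult_scale: "x \<cdot> (c *s y) = c *s (x \<cdot> y)"
begin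

definition is_ideal :: "'a set \<Rightarrow> bool" where
  "is_ideal I \<longleftrightarrow> subspace I \<and> (\<forall>x\<in>I. \<forall>a. a \<cdot> x \<in> I \<and> x \<cdot> a \<in> I)"

definition ideal_mult :: "'a set \<Rightarrow> 'a set \<Rightarrow> 'a set" where
  "ideal_mult I J = span {x \<cdot> y | x y. x \<in> I \<and> y \<in> J}"

text \<open>The zero algebra is not excluded.\<close>

definition prime_algebra :: bool where
  "prime_algebra \<longleftrightarrow>
    (\<forall>I J. is_ideal I \<longrightarrow> is_ideal J \<longrightarrow> ideal_mult I J = {0} \<longrightarrow> I = {0} \<or> J = {0})"

text \<open>
  A basis is a set of vectors, indexed by itself.
\<close>

definition natural_basis :: "'a set \<Rightarrow> bool" where
  "natural_basis B \<longleftrightarrow>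
    independent B \<and> span B = UNIV \<and> (\<forall>e\<in>B. \<forall>f\<in>B. e \<noteq> f \<longrightarrow> e \<cdot> f = 0)"

text \<open>
  \<open>structure_const B f e\<close> is the coefficient of \<open>f\<close> in \<open>e \<cdot> e\<close>, i.e. \<open>\<omega>\<^sub>j\<^sub>i\<close> for
  \<open>f = e\<^sub>j\<close> and \<open>e = e\<^sub>i\<close>.
\<close>

definition structure_const :: "'a set \<Rightarrow> 'a \<Rightarrow> 'a \<Rightarrow> 'k" where
  "structure_const B f e = representation B (e \<cdot> e) f"

definition assoc_graph :: "'a set \<Rightarrow> ('a, 'a \<times> 'a) pre_digraph" where
  "assoc_graph B =
    \<lparr>verts = B,
     arcs = {(e, f). e \<in> B \<and> f \<in> B \<and> structure_const B f e \<noteq> 0},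
     tail = fst, head = snd\<rparr>"

end

locale evolution_algebra = nonassoc_algebra +
  assumes ex_natural_basis: "\<exists>B. natural_basis B"

text \<open>
  A directed path may repeat vertices and arcs, and may have length 0, so it is an arc walk.
\<close>

definition path_ge :: "('a, 'b) pre_digraph \<Rightarrow> 'a \<Rightarrow> 'a \<Rightarrow> bool" where
  "path_ge G u v \<longleftrightarrow> (\<exists>p. pre_digraph.awalk G u p v)"

definition downward_directed :: "('a, 'b) pre_digraph \<Rightarrow> bool" where
  "downward_directed G \<longleftrightarrow>
    (\<forall>u\<in>verts G. \<forall>v\<in>verts G. \<exists>z\<in>verts G. path_ge G u z \<and> path_ge G v z)"

end

theory Submission
  imports Defs
begin

text \<open>
  The vertices reachable from a vertex \<open>u\<close> form a set \<open>H\<close> closed under out-neighbours, and the span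
  of such a set is an ideal: multiplying \<open>e \<in> H\<close> by an arbitrary element kills every basis
  component except the one along \<open>e\<close>, which leaves a multiple of \<open>e \<cdot> e\<close>, and the squares of
  elements of \<open>H\<close> are combinations of their out-neighbours (\<open>is_ideal_span_hereditary\<close>).
  If \<open>u\<close> and \<open>v\<close> had no common descendant, the ideals spanned by their descendants would come from
  disjoint sets of basis vectors, so their product would vanish (\<open>ideal_mult_span_disjoint\<close>).
  Each contains a basis vector, hence is nonzero, and this contradicts primeness.
\<close>

context nonassoc_algebra
begin

text \<open>
  Bilinearity: each of the two one-sided preimages of a subspace under multiplication is a
  subspace, so membership of products may be checked on spanning sets.
\<close>

lemma mult_mem_subspace_of_span:
  assumes S: "subspace S"
    and gen: "\<And>x y. x \<in> X \<Longrightarrow> y \<in> Y \<Longrightarrow> x \<cdot> y \<in> S"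
    and x: "x \<in> span X" and y: "y \<in> span Y"
  shows "x \<cdot> y \<in> S"
proof -
  have zero_mult: "0 \<cdot> z = 0" and mult_zero: "z \<cdot> 0 = 0" for z
    using scale_mult[of 0 0 z] mult_scale[of z 0 0] by simp_all
  have right: "x' \<cdot> y \<in> S" if "x' \<in> X" for x'
  proof -
    have "subspace {z. x' \<cdot> z \<in> S}"
      using S by (simp add: subspace_def mult_zero mult_add mult_scale)
    then have "span Y \<subseteq> {z. x' \<cdot> z \<in> S}"
      using gen that by (intro span_minimal) auto
    with y show ?thesis by auto
  qed
  have "subspace {z. z \<cdot> y \<in> S}"
    using S by (simp add: subspace_def zero_mult add_mult scale_mult)
  then have "span X \<subseteq> {z. z \<cdot> y \<in> S}"
    using right by (intro span_minimal) auto
  with x show ?thesis by auto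
qed

lemma is_ideal_span_hereditary:
  assumes B: "natural_basis B" and "H \<subseteq> B"
    and hereditary: "\<And>e f. e \<in> H \<Longrightarrow> (e, f) \<in> arcs (assoc_graph B) \<Longrightarrow> f \<in> H"
  shows "is_ideal (span H)"
proof -
  have indep: "independent B" and spanB: "span B = UNIV"
    and orth: "\<And>e f. e \<in> B \<Longrightarrow> f \<in> B \<Longrightarrow> e \<noteq> f \<Longrightarrow> e \<cdot> f = 0"
    using B by (auto simp: natural_basis_def)
  have square: "e \<cdot> e \<in> span H" if "e \<in> H" for e
  proof -
    have "f \<in> H" if "representation B (e \<cdot> e) f \<noteq> 0" for f
      using hereditary[OF \<open>e \<in> H\<close>, of f] representation_ne_zero[OF that] \<open>e \<in> H\<close> \<open>H \<subseteq> B\<close> that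
      by (auto simp: assoc_graph_def structure_const_def)
    then have "(\<Sum>f | representation B (e \<cdot> e) f \<noteq> 0. representation B (e \<cdot> e) f *s f) \<in> span H"
      by (intro span_sum span_scale span_base) auto
    then show ?thesis
      using sum_nonzero_representation_eq[OF indep, of "e \<cdot> e"] spanB by simp
  qed
  have "e \<cdot> f \<in> span H \<and> f \<cdot> e \<in> span H" if "e \<in> H" "f \<in> B" for e f
    using that \<open>H \<subseteq> B\<close> square orth span_zero by (cases "e = f") auto
  then have "x \<cdot> a \<in> span H" "a \<cdot> x \<in> span H" if "x \<in> span H" for x a
    using that spanB
    by (auto intro: mult_mem_subspace_of_span[of "span H" H B]
        mult_mem_subspace_of_span[of "span H" B H])
  then show ?thesis
    by (simp add: is_ideal_def)
qed

lemma ideal_mult_span_disjoint: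
  assumes B: "natural_basis B" and "H \<subseteq> B" "K \<subseteq> B" and disj: "H \<inter> K = {}"
  shows "ideal_mult (span H) (span K) = {0}"
proof -
  have "x \<cdot> y \<in> {0}" if "x \<in> H" "y \<in> K" for x y
  proof -
    have "x \<in> B" "y \<in> B" "x \<noteq> y"
      using assms that by auto
    with B show ?thesis by (simp add: natural_basis_def)
  qed
  then have "x \<cdot> y \<in> {0}" if "x \<in> span H" "y \<in> span K" for x y
    by (rule mult_mem_subspace_of_span[OF subspace_single_0 _ that])
  then have "{x \<cdot> y | x y. x \<in> span H \<and> y \<in> span K} \<subseteq> {0}"
    by auto
  then have "ideal_mult (span H) (span K) \<subseteq> {0}"
    unfolding ideal_mult_def by (rule span_minimal[OF _ subspace_single_0])
  moreover have "0 \<in> ideal_mult (span H) (span K)"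
    unfolding ideal_mult_def by (rule span_zero)
  ultimately show ?thesis by blast
qed

lemma wf_digraph_assoc_graph: "wf_digraph (assoc_graph B)"
  by unfold_locales (auto simp: assoc_graph_def)

lemma path_ge_assoc_graph_refl: "u \<in> B \<Longrightarrow> path_ge (assoc_graph B) u u"
  unfolding path_ge_def
  using wf_digraph.awalk_Nil_iff[OF wf_digraph_assoc_graph, of B u u]
  by (auto simp: assoc_graph_def)

lemma path_ge_assoc_graph_step:
  assumes "path_ge (assoc_graph B) u e" and arc: "(e, f) \<in> arcs (assoc_graph B)"
  shows "path_ge (assoc_graph B) u f"
proof -
  interpret wf_digraph "assoc_graph B" by (rule wf_digraph_assoc_graph)
  obtain p where "awalk u p e"
    using assms(1) unfolding path_ge_def by (rule exE)
  moreover have "awalk e [(e, f)] f"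
    using arc_implies_awalk[OF arc] by (simp add: assoc_graph_def)
  ultimately show ?thesis
    unfolding path_ge_def by (intro exI) (rule awalk_appendI)
qed

lemma downward_directed_assoc_graph:
  assumes B: "natural_basis B" and prime: prime_algebra
  shows "downward_directed (assoc_graph B)"
proof -
  have verts: "verts (assoc_graph B) = B"
    by (simp add: assoc_graph_def)
  define H where "H u = {z \<in> B. path_ge (assoc_graph B) u z}" for u
  have ideal: "is_ideal (span (H u))" for u
  proof (rule is_ideal_span_hereditary[OF B])
    show "H u \<subseteq> B" by (auto simp: H_def)
    fix e f
    assume "e \<in> H u" and arc: "(e, f) \<in> arcs (assoc_graph B)"
    then have "path_ge (assoc_graph B) u f"
      by (auto simp: H_def intro: path_ge_assoc_graph_step)
    moreover have "f \<in> B"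
      using arc by (simp add: assoc_graph_def)
    ultimately show "f \<in> H u" by (simp add: H_def)
  qed
  have nonzero: "span (H u) \<noteq> {0}" if "u \<in> B" for u
  proof -
    have "u \<in> span (H u)"
      using that by (auto simp: H_def intro: span_base path_ge_assoc_graph_refl)
    moreover have "u \<noteq> 0"
      using B that dependent_zero by (auto simp: natural_basis_def)
    ultimately show ?thesis by blast
  qed
  have "H u \<inter> H v \<noteq> {}" if "u \<in> B" "v \<in> B" for u v
  proof
    assume "H u \<inter> H v = {}"
    then have "ideal_mult (span (H u)) (span (H v)) = {0}"
      by (intro ideal_mult_span_disjoint[OF B]) (auto simp: H_def)
    then have "span (H u) = {0} \<or> span (H v) = {0}"
      using prime ideal[of u] ideal[of v] unfolding prime_algebra_def by simp
    with nonzero that show False by simp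
  qed
  then have "\<exists>z\<in>B. path_ge (assoc_graph B) u z \<and> path_ge (assoc_graph B) v z"
    if "u \<in> B" "v \<in> B" for u v
    using that unfolding H_def by fast
  then show ?thesis
    by (simp add: downward_directed_def verts)
qed

end

theorem theorem3p13:
  fixes scale :: "'k::field \<Rightarrow> 'a::ab_group_add \<Rightarrow> 'a"
    and mult :: "'a \<Rightarrow> 'a \<Rightarrow> 'a"
    and B :: "'a set"
  assumes "evolution_algebra scale mult"
    and "nonassoc_algebra.natural_basis scale mult B"
    and "nonassoc_algebra.prime_algebra scale mult"
  shows "downward_directed (nonassoc_algebra.assoc_graph scale mult B)"
proof -
  interpret evolution_algebra scale mult by fact
  show ?thesis
    using assms(2,3) by (rule downward_directed_assoc_graph)
qed

end
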